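(* Let $G$ be a finite simple graph with at least one edge. If $G$ is uniquely distinguishing colorable, then either $G$ is connected, or $G$ is isomorphic to $H\cup H$ (the disjoint union of two copies of $H$), where $H$ is a connected uniquely distinguishing colorable graph of type 2.
   Context: All graphs are finite and simple. A distinguishing $k$-coloring of a graph $G$ is a partition of $V(G)$ into exactly $k$ non-empty classes, each an independent set, such that the only automorphism $f$ of $G$ with $f(V_i)=V_i$ for every class $V_i$ is the identity. The distinguishing chromatic number $\chi_D(G)$ is the least $k$ for which a distinguishing $k$-coloring exists. $G$ is uniquely distinguishing colorable if there is exactly one partition of $V(G)$ into $\chi_D(G)$ classes forming a distinguishing coloring. For a connected uniquely distinguishing colorable graph $G$ with unique optimal partition $\{V_1,\dots,V_{\chi_D(G)}\}$, a labeling of the color classes is a bijective assignment of the labels $1,\dots,\chi_D(G)$ to the classes. $G$ is of type 1 if, whenever the two components of $G\cup G$ are each colored by this partition with arbitrary labelings (using the labels $1,\dots,\chi_D(G)$), there exists an isomorphism from one component onto the other preserving all labels; otherwise $G$ is of type 2. *)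

theory Defs
  imports "Graph_Theory.Graph_Theory" "HOL-Library.Disjoint_Sets"
begin

text \<open>
  A finite simple graph is a \<open>pair_graph\<close>: a finite vertex set with a symmetric, irreflexive arc
  relation on it, each edge being represented by its two arcs. The coercion \<open>with_proj\<close>
  gives access to the notions for general digraphs. The library's \<open>connected\<close>
  includes non-emptiness.
\<close>

text \<open>
  The library's isomorphisms \<open>digraph_isomorphism\<close> act on vertices and on arcs.
  In a simple graph the action on vertices determines the one on arcs, so we
  work with vertex maps; see \<open>digraph_iso_iff_graph_isomorphism\<close> below.
\<close>

definition graph_isomorphism ::
    "('a \<Rightarrow> 'b) \<Rightarrow> ('a, 'c) pre_digraph \<Rightarrow> ('b, 'd) pre_digraph \<Rightarrow> bool" where
  "graph_isomorphism f G H \<longleftrightarrow>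
     bij_betw f (verts G) (verts H) \<and>
     (\<forall>u\<in>verts G. \<forall>v\<in>verts G. u \<rightarrow>\<^bsub>G\<^esub> v \<longleftrightarrow> f u \<rightarrow>\<^bsub>H\<^esub> f v)"

abbreviation graph_automorphism :: "('a \<Rightarrow> 'a) \<Rightarrow> ('a, 'c) pre_digraph \<Rightarrow> bool" where
  "graph_automorphism f G \<equiv> graph_isomorphism f G G"

definition independent_set :: "('a, 'c) pre_digraph \<Rightarrow> 'a set \<Rightarrow> bool" where
  "independent_set G C \<longleftrightarrow> C \<subseteq> verts G \<and> (\<forall>u\<in>C. \<forall>v\<in>C. \<not> u \<rightarrow>\<^bsub>G\<^esub> v)"

text \<open>
  A colouring is the partition into colour classes, not a labelled colouring.
  Vertex maps are total functions, so being the identity is only required on the vertex set.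
\<close>

definition distinguishing_coloring :: "'a pair_pre_digraph \<Rightarrow> nat \<Rightarrow> 'a set set \<Rightarrow> bool" where
  "distinguishing_coloring G k P \<longleftrightarrow>
     partition_on (pverts G) P \<and> card P = k \<and>
     (\<forall>C\<in>P. independent_set G C) \<and>
     (\<forall>f. graph_automorphism f G \<and> (\<forall>C\<in>P. f ` C = C) \<longrightarrow> (\<forall>v\<in>pverts G. f v = v))"

definition dist_chromatic_number :: "'a pair_pre_digraph \<Rightarrow> nat" where
  "dist_chromatic_number G = (LEAST k. \<exists>P. distinguishing_coloring G k P)"

definition uniquely_distinguishing_colorable :: "'a pair_pre_digraph \<Rightarrow> bool" where
  "uniquely_distinguishing_colorable G \<longleftrightarrow>
     (\<exists>!P. distinguishing_coloring G (dist_chromatic_number G) P)"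

definition optimal_partition :: "'a pair_pre_digraph \<Rightarrow> 'a set set" where
  "optimal_partition G = (THE P. distinguishing_coloring G (dist_chromatic_number G) P)"

definition disjoint_union ::
    "'a pair_pre_digraph \<Rightarrow> 'b pair_pre_digraph \<Rightarrow> ('a + 'b) pair_pre_digraph" where
  "disjoint_union G H =
     \<lparr> pverts = pverts G <+> pverts H,
       parcs = map_prod Inl Inl ` parcs G \<union> map_prod Inr Inr ` parcs H \<rparr>"

definition class_labeling :: "'a pair_pre_digraph \<Rightarrow> ('a set \<Rightarrow> nat) \<Rightarrow> bool" where
  "class_labeling G l \<longleftrightarrow> bij_betw l (optimal_partition G) {1..dist_chromatic_number G}"

definition vertex_label :: "'a pair_pre_digraph \<Rightarrow> ('a set \<Rightarrow> nat) \<Rightarrow> 'a \<Rightarrow> nat" where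
  "vertex_label G l v = l (THE C. C \<in> optimal_partition G \<and> v \<in> C)"

text \<open>
  The types are meant for connected uniquely distinguishing colorable graphs only. For these the
  two components of \<open>disjoint_union G G\<close> are the subgraphs induced by the left and by the
  right copy of the vertices, which are labelled by \<open>l\<^sub>1\<close> and \<open>l\<^sub>2\<close> respectively.
\<close>

definition type_1 :: "'a pair_pre_digraph \<Rightarrow> bool" where
  "type_1 G \<longleftrightarrow>
     (\<forall>l\<^sub>1 l\<^sub>2. class_labeling G l\<^sub>1 \<and> class_labeling G l\<^sub>2 \<longrightarrow>
        (let U = with_proj (disjoint_union G G);
             lab = case_sum (vertex_label G l\<^sub>1) (vertex_label G l\<^sub>2)
         in \<exists>f. graph_isomorphism f (U \<restriction> Inl ` pverts G) (U \<restriction> Inr ` pverts G) \<and>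
                (\<forall>x\<in>Inl ` pverts G. lab (f x) = lab x)))"

definition type_2 :: "'a pair_pre_digraph \<Rightarrow> bool" where
  "type_2 G \<longleftrightarrow> \<not> type_1 G"

lemma digraph_iso_iff_graph_isomorphism:
  assumes "pair_wf_digraph G" and "pair_wf_digraph H"
  shows "digraph_iso (with_proj G) (with_proj H) \<longleftrightarrow> (\<exists>f. graph_isomorphism f G H)"
proof
  assume "digraph_iso (with_proj G) (with_proj H)"
  then obtain h where h: "pre_digraph.digraph_isomorphism (with_proj G) h"
    and H: "with_proj H = app_iso h (with_proj G)"
    unfolding digraph_iso_def by blast
  have v: "pverts H = iso_verts h ` pverts G" and a: "parcs H = iso_arcs h ` parcs G"
    and t: "iso_tail h = fst" and d: "iso_head h = snd"
    using H by (simp_all add: app_iso_def with_proj_def)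
  have arc: "iso_arcs h e = (iso_verts h (fst e), iso_verts h (snd e))" if "e \<in> parcs G" for e
    using h that t d unfolding pre_digraph.digraph_isomorphism_def by (auto simp: prod_eq_iff)
  have inj: "inj_on (iso_verts h) (pverts G)"
    using h unfolding pre_digraph.digraph_isomorphism_def by auto
  have wG: "fst e \<in> pverts G \<and> snd e \<in> pverts G" if "e \<in> parcs G" for e
    using pair_wf_digraph.arc_fst_in_verts[OF assms(1) that]
      pair_wf_digraph.arc_snd_in_verts[OF assms(1) that] by blast
  have "(u, v) \<in> parcs G \<longleftrightarrow> (iso_verts h u, iso_verts h v) \<in> parcs H"
    if uv: "u \<in> pverts G" "v \<in> pverts G" for u v
  proof
    assume "(u, v) \<in> parcs G"
    then have "iso_arcs h (u, v) \<in> parcs H" and "iso_arcs h (u, v) = (iso_verts h u, iso_verts h v)"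
      using arc[of "(u, v)"] unfolding a by (blast, simp)
    then show "(iso_verts h u, iso_verts h v) \<in> parcs H" by simp
  next
    assume "(iso_verts h u, iso_verts h v) \<in> parcs H"
    then obtain e where e: "e \<in> parcs G" "iso_arcs h e = (iso_verts h u, iso_verts h v)"
      unfolding a by (metis imageE)
    then have "iso_verts h (fst e) = iso_verts h u" "iso_verts h (snd e) = iso_verts h v"
      using arc[OF e(1)] by simp_all
    then have "fst e = u" "snd e = v"
      using inj wG[OF e(1)] uv by (auto dest: inj_onD)
    then show "(u, v) \<in> parcs G" using e(1) by auto
  qed
  then have "graph_isomorphism (iso_verts h) G H"
    using inj v by (simp add: graph_isomorphism_def bij_betw_def)
  then show "\<exists>f. graph_isomorphism f G H" by blast
next
  assume "\<exists>f. graph_isomorphism f G H"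
  then obtain f where f: "bij_betw f (pverts G) (pverts H)"
    and e: "\<And>u v. u \<in> pverts G \<Longrightarrow> v \<in> pverts G \<Longrightarrow> (u, v) \<in> parcs G \<longleftrightarrow> (f u, f v) \<in> parcs H"
    unfolding graph_isomorphism_def by auto
  have wG: "fst a \<in> pverts G \<and> snd a \<in> pverts G" if "a \<in> parcs G" for a
    using pair_wf_digraph.arc_fst_in_verts[OF assms(1) that]
      pair_wf_digraph.arc_snd_in_verts[OF assms(1) that] by blast
  have wH: "fst a \<in> pverts H \<and> snd a \<in> pverts H" if "a \<in> parcs H" for a
    using pair_wf_digraph.arc_fst_in_verts[OF assms(2) that]
      pair_wf_digraph.arc_snd_in_verts[OF assms(2) that] by blast
  define h where "h = \<lparr> iso_verts = f, iso_arcs = map_prod f f, iso_head = snd, iso_tail = fst \<rparr>"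
  have inj: "inj_on f (pverts G)" and im: "f ` pverts G = pverts H"
    using f by (auto simp: bij_betw_def)
  have "inj_on (map_prod f f) (parcs G)"
    using wG inj by (auto simp: inj_on_def prod_eq_iff)
  then have "pre_digraph.digraph_isomorphism (with_proj G) h"
    using assms(1) inj unfolding pre_digraph.digraph_isomorphism_def
    by (simp add: h_def wf_digraph_wp_iff)
  moreover have "map_prod f f ` parcs G = parcs H"
  proof
    show "map_prod f f ` parcs G \<subseteq> parcs H"
    proof
      fix a assume "a \<in> map_prod f f ` parcs G"
      then obtain u v where uv: "(u, v) \<in> parcs G" "a = (f u, f v)" by auto
      moreover have "u \<in> pverts G" "v \<in> pverts G" using wG[OF uv(1)] by simp_all
      ultimately show "a \<in> parcs H" using e by blast
    qed
    show "parcs H \<subseteq> map_prod f f ` parcs G"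
    proof
      fix a assume a: "a \<in> parcs H"
      then have "fst a \<in> f ` pverts G" "snd a \<in> f ` pverts G" using wH im by blast+
      then obtain u v where uv: "u \<in> pverts G" "v \<in> pverts G" "fst a = f u" "snd a = f v"
        by blast
      then have af: "a = map_prod f f (u, v)" by (simp add: prod_eq_iff)
      then have "(u, v) \<in> parcs G" using a e[OF uv(1,2)] by simp
      then show "a \<in> map_prod f f ` parcs G" unfolding af by (rule imageI)
    qed
  qed
  then have "with_proj H = app_iso h (with_proj G)"
    using im by (simp add: app_iso_def with_proj_def h_def)
  ultimately show "digraph_iso (with_proj G) (with_proj H)"
    unfolding digraph_iso_def by blast
qed

end

theory Submission
  imports Defs "HOL-Combinatorics.Transposition"
begin

text \<open>
  A proper labelling \<open>c\<close> is distinguishing iff every colour-preserving isomorphism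
  between two components is an identity map. So a distinguishing labelling may be modified component
  by component, as long as no two components become isomorphic as coloured graphs; if \<open>G\<close>
  is uniquely colourable, each modification without additional colours must return the same colour
  classes or fail to be distinguishing. Let \<open>G\<close> be disconnected.

  Transposing two colours on all components of one isomorphism type shows that there is only one
  type. Transposing two colours on a single component \<open>C\<close> must turn \<open>C\<close> into a
  coloured copy of another component, which excludes a colour occurring only in \<open>C\<close>.
  Composing \<open>c\<close> with the automorphism exchanging two components leaves the classes
  unchanged, so a colour that it moves does not occur in a third component. Hence a third component
  would yield a colour occurring in a single component, and there are exactly two
  components, both using all colours. Recolouring only one of them shows that it is uniquely
  colourable; as the two are not isomorphic as coloured graphs, it is of type 2.
\<close>

section \<open>Labellings of vertices in place of partitions\<close>

definition same_classes :: "'a set \<Rightarrow> ('a \<Rightarrow> 'b) \<Rightarrow> ('a \<Rightarrow> 'c) \<Rightarrow> bool" where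
  "same_classes V c d \<longleftrightarrow> (\<forall>u\<in>V. \<forall>v\<in>V. c u = c v \<longleftrightarrow> d u = d v)"

definition classes :: "'a set \<Rightarrow> ('a \<Rightarrow> 'b) \<Rightarrow> 'a set set" where
  "classes V c = (\<lambda>v. {u \<in> V. c u = c v}) ` V"

text \<open>Unlike in \<open>distinguishing_coloring\<close>, the number of colours is left open.
  Counting them separately lets a recolouring be judged by the set of colours it uses.\<close>

definition distinguishing :: "'a pair_pre_digraph \<Rightarrow> ('a \<Rightarrow> 'b) \<Rightarrow> bool" where
  "distinguishing G c \<longleftrightarrow>
     (\<forall>u v. (u, v) \<in> parcs G \<longrightarrow> c u \<noteq> c v) \<and>
     (\<forall>f. graph_automorphism f G \<and> (\<forall>v\<in>pverts G. c (f v) = c v) \<longrightarrow> (\<forall>v\<in>pverts G. f v = v))"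

lemma partition_on_classes: "partition_on V (classes V c)"
  unfolding partition_on_def disjoint_def classes_def by auto

lemma classes_eq_iff: "classes V c = classes V d \<longleftrightarrow> same_classes V c d"
proof
  assume *: "classes V c = classes V d"
  have "{u \<in> V. c u = c v} = {u \<in> V. d u = d v}" if v: "v \<in> V" for v
  proof -
    have "{u \<in> V. c u = c v} \<in> classes V d"
      unfolding *[symmetric] using v by (auto simp: classes_def)
    then obtain w where w: "{u \<in> V. c u = c v} = {u \<in> V. d u = d w}"
      by (auto simp: classes_def)
    moreover have "v \<in> {u \<in> V. c u = c v}" using v by simp
    ultimately show ?thesis by auto
  qed
  then show "same_classes V c d" unfolding same_classes_def by blast
next
  assume "same_classes V c d"
  then have "{u \<in> V. c u = c v} = {u \<in> V. d u = d v}" if "v \<in> V" for v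
    using that unfolding same_classes_def by blast
  then show "classes V c = classes V d" unfolding classes_def by (rule image_cong[OF refl])
qed

lemma bij_betw_classes:
  "bij_betw (\<lambda>X. the_elem (c ` X)) (classes V c) (c ` V)"
proof -
  have el: "the_elem (c ` {u \<in> V. c u = c v}) = c v" if "v \<in> V" for v
  proof -
    have "c ` {u \<in> V. c u = c v} = {c v}" using that by auto
    then show ?thesis by simp
  qed
  have "inj_on (\<lambda>X. the_elem (c ` X)) (classes V c)"
  proof (rule inj_onI)
    fix X Y assume "X \<in> classes V c" "Y \<in> classes V c"
      and eq: "the_elem (c ` X) = the_elem (c ` Y)"
    then obtain x y where "x \<in> V" "X = {u \<in> V. c u = c x}" "y \<in> V" "Y = {u \<in> V. c u = c y}"
      unfolding classes_def by blast
    with eq el[of x] el[of y] show "X = Y" by simp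
  qed
  moreover have "(\<lambda>X. the_elem (c ` X)) ` classes V c = c ` V"
    unfolding classes_def image_image by (rule image_cong[OF refl el])
  ultimately show ?thesis by (simp add: bij_betw_def)
qed

lemma card_classes: "card (classes V c) = card (c ` V)"
  using bij_betw_classes by (rule bij_betw_same_card)

text \<open>Number the finitely many blocks injectively and give each vertex the number of its
  block. Hence natural numbers suffice as colours throughout.\<close>

lemma partition_on_eq_classes:
  assumes "finite V" and P: "partition_on V P"
  obtains c :: "'a \<Rightarrow> nat" where "P = classes V c"
proof -
  have "finite P" by (rule finite_elements[OF assms])
  then obtain g :: "'a set \<Rightarrow> nat" where g: "inj_on g P"
    using finite_imp_inj_to_nat_seg[of P] by auto
  define c where "c v = g (THE X. X \<in> P \<and> v \<in> X)" for v
  have the: "(THE X. X \<in> P \<and> v \<in> X) = X" if X: "X \<in> P" "v \<in> X" for X v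
  proof (rule the_equality)
    show "X \<in> P \<and> v \<in> X" using X by simp
    show "Y = X" if "Y \<in> P \<and> v \<in> Y" for Y
      using X that partition_onD2[OF P] by (auto dest: disjointD)
  qed
  have cl: "{u \<in> V. c u = c v} = X" if X: "X \<in> P" "v \<in> X" for X v
  proof
    show "X \<subseteq> {u \<in> V. c u = c v}"
      using X P by (auto simp: c_def the partition_on_def)
    show "{u \<in> V. c u = c v} \<subseteq> X"
    proof
      fix u assume u: "u \<in> {u \<in> V. c u = c v}"
      then obtain Y where Y: "Y \<in> P" "u \<in> Y" using P by (auto simp: partition_on_def)
      then have "g Y = g X" using u X by (simp add: c_def the)
      then show "u \<in> X" using g Y X by (auto dest: inj_onD)
    qed
  qed
  have "P = classes V c"
  proof
    show "P \<subseteq> classes V c"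
    proof
      fix X assume X: "X \<in> P"
      then have "X \<noteq> {}" using partition_onD3[OF P] by blast
      then obtain v where v: "v \<in> X" by blast
      then have "v \<in> V" using X P by (auto simp: partition_on_def)
      then show "X \<in> classes V c" unfolding classes_def cl[OF X v, symmetric] by blast
    qed
    show "classes V c \<subseteq> P"
    proof
      fix X assume "X \<in> classes V c"
      then obtain v where v: "v \<in> V" "X = {u \<in> V. c u = c v}" by (auto simp: classes_def)
      then obtain Y where Y: "Y \<in> P" "v \<in> Y" using P by (auto simp: partition_on_def)
      then show "X \<in> P" using cl v by simp
    qed
  qed
  then show thesis by (rule that)
qed

lemma graph_isomorphism_with_proj:
  "graph_isomorphism f (with_proj G) (with_proj H) \<longleftrightarrow>
     bij_betw f (pverts G) (pverts H) \<and>
     (\<forall>u\<in>pverts G. \<forall>v\<in>pverts G. (u, v) \<in> parcs G \<longleftrightarrow> (f u, f v) \<in> parcs H)"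
  by (simp add: graph_isomorphism_def)

lemma graph_isomorphism_inv_into:
  assumes "graph_isomorphism f G H"
  shows "graph_isomorphism (inv_into (verts G) f) H G"
proof -
  have f: "bij_betw f (verts G) (verts H)"
    using assms by (simp add: graph_isomorphism_def)
  have i: "inv_into (verts G) f u \<in> verts G" "f (inv_into (verts G) f u) = u" if "u \<in> verts H" for u
    using f that by (auto simp: bij_betw_def inv_into_into f_inv_into_f)
  show ?thesis
    using assms bij_betw_inv_into[OF f] i unfolding graph_isomorphism_def by simp
qed

lemma graph_isomorphism_comp:
  assumes "graph_isomorphism f G H" and "graph_isomorphism g H K"
  shows "graph_isomorphism (g \<circ> f) G K"
proof -
  have f: "bij_betw f (verts G) (verts H)"
    using assms(1) by (simp add: graph_isomorphism_def)
  have "bij_betw g (verts H) (verts K)"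
    using assms(2) by (simp add: graph_isomorphism_def)
  with f have "bij_betw (g \<circ> f) (verts G) (verts K)" by (rule bij_betw_trans)
  then show ?thesis
    using assms bij_betw_apply[OF f] unfolding graph_isomorphism_def by simp
qed

lemma distinguishing_coloring_classes:
  assumes "pair_graph G"
  shows "distinguishing_coloring G k (classes (pverts G) c) \<longleftrightarrow>
    distinguishing G c \<and> card (c ` pverts G) = k"
proof -
  interpret pair_graph G by fact
  have ind: "(\<forall>C\<in>classes (pverts G) c. independent_set G C) \<longleftrightarrow>
      (\<forall>u v. (u, v) \<in> parcs G \<longrightarrow> c u \<noteq> c v)"
  proof safe
    fix u v assume *: "\<forall>C\<in>classes (pverts G) c. independent_set G C" "(u, v) \<in> parcs G" "c u = c v"
    then have "u \<in> pverts G" "v \<in> pverts G"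
      using arc_fst_in_verts arc_snd_in_verts by force+
    then show False
      using * by (auto simp: independent_set_def classes_def)
  next
    fix C assume proper: "\<forall>u v. (u, v) \<in> parcs G \<longrightarrow> c u \<noteq> c v" and "C \<in> classes (pverts G) c"
    then obtain x where C: "C = {u \<in> pverts G. c u = c x}" by (auto simp: classes_def)
    show "independent_set G C"
      unfolding independent_set_def C
    proof (intro conjI ballI notI)
      fix u v assume "u \<in> {u \<in> pverts G. c u = c x}" "v \<in> {u \<in> pverts G. c u = c x}" "u \<rightarrow>\<^bsub>G\<^esub> v"
      then show False using proper by force
    qed simp
  qed
  have pres: "(\<forall>C\<in>classes (pverts G) c. f ` C = C) \<longleftrightarrow> (\<forall>v\<in>pverts G. c (f v) = c v)"
    if f: "graph_automorphism f G" for f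
  proof
    assume "\<forall>C\<in>classes (pverts G) c. f ` C = C"
    then show "\<forall>v\<in>pverts G. c (f v) = c v" unfolding classes_def by auto
  next
    assume c: "\<forall>v\<in>pverts G. c (f v) = c v"
    have b: "bij_betw f (pverts G) (pverts G)" using f by (simp add: graph_isomorphism_with_proj)
    show "\<forall>C\<in>classes (pverts G) c. f ` C = C"
    proof
      fix C assume C: "C \<in> classes (pverts G) c"
      then have sub: "C \<subseteq> pverts G" by (auto simp: classes_def)
      \<comment> \<open>Preserving colours yields only this inclusion; injectivity of
        \<open>f\<close> on the finite set \<open>C\<close> makes it an equality.\<close>
      have "f ` C \<subseteq> C" using C c b by (auto simp: classes_def bij_betw_def)
      moreover have "inj_on f C" using b sub by (auto simp: bij_betw_def intro: inj_on_subset)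
      ultimately show "f ` C = C"
        using endo_inj_surj pair_finite_verts sub finite_subset by metis
    qed
  qed
  have "(graph_automorphism f G \<and> (\<forall>C\<in>classes (pverts G) c. f ` C = C)) \<longleftrightarrow>
      (graph_automorphism f G \<and> (\<forall>v\<in>pverts G. c (f v) = c v))" for f
    by (rule conj_cong[OF refl pres])
  note pres' = this
  show ?thesis
    unfolding distinguishing_coloring_def distinguishing_def ind card_classes pres'
    by (auto simp: partition_on_classes)
qed

text \<open>By minimality of the distinguishing chromatic number no distinguishing labelling uses
  fewer colours than \<open>c\<close>. So uniqueness can be stated with an inequality, and a
  recolouring only has to avoid additional colours.\<close>

lemma uniquely_distinguishing_colorableD:
  assumes "pair_graph G" and "uniquely_distinguishing_colorable G"
  obtains c :: "'a \<Rightarrow> nat" where "distinguishing G c"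
    and "\<And>d :: 'a \<Rightarrow> nat. distinguishing G d \<Longrightarrow> card (d ` pverts G) \<le> card (c ` pverts G) \<Longrightarrow>
           same_classes (pverts G) d c"
proof -
  interpret pair_graph G by fact
  let ?k = "dist_chromatic_number G"
  obtain P where P: "distinguishing_coloring G ?k P"
    and uniq: "\<And>Q. distinguishing_coloring G ?k Q \<Longrightarrow> Q = P"
    using assms(2) unfolding uniquely_distinguishing_colorable_def by blast
  then obtain c :: "'a \<Rightarrow> nat" where c: "P = classes (pverts G) c"
    using partition_on_eq_classes[OF pair_finite_verts]
    unfolding distinguishing_coloring_def by metis
  have dc: "distinguishing G c" "card (c ` pverts G) = ?k"
    using P distinguishing_coloring_classes[OF assms(1)] unfolding c by auto
  show thesis
  proof (rule that[OF dc(1)])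
    fix d :: "'a \<Rightarrow> nat"
    assume d: "distinguishing G d" "card (d ` pverts G) \<le> card (c ` pverts G)"
    then have dk: "distinguishing_coloring G (card (d ` pverts G)) (classes (pverts G) d)"
      using distinguishing_coloring_classes[OF assms(1)] by auto
    then have "?k \<le> card (d ` pverts G)"
      unfolding dist_chromatic_number_def by (intro Least_le) blast
    then have "card (d ` pverts G) = ?k" using d dc by simp
    then have "classes (pverts G) d = P" using dk uniq by simp
    then show "same_classes (pverts G) d c" unfolding c classes_eq_iff .
  qed
qed

text \<open>Uniqueness among labellings with at most as many colours includes optimality: a
  labelling with the same classes as \<open>c\<close> also has the same number of them.\<close>

lemma uniquely_distinguishing_colorableI:
  fixes c :: "'a \<Rightarrow> nat"
  assumes "pair_graph G" and c: "distinguishing G c"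
    and uniq: "\<And>d :: 'a \<Rightarrow> nat. distinguishing G d \<Longrightarrow>
      card (d ` pverts G) \<le> card (c ` pverts G) \<Longrightarrow> same_classes (pverts G) d c"
  shows "dist_chromatic_number G = card (c ` pverts G)"
    and "uniquely_distinguishing_colorable G"
    and "optimal_partition G = classes (pverts G) c"
proof -
  interpret pair_graph G by fact
  let ?k = "card (c ` pverts G)"
  have eq: "Q = classes (pverts G) c \<and> j = ?k" if Q: "distinguishing_coloring G j Q" and j: "j \<le> ?k" for Q j
  proof -
    obtain d :: "'a \<Rightarrow> nat" where d: "Q = classes (pverts G) d"
      using partition_on_eq_classes[OF pair_finite_verts] Q
      unfolding distinguishing_coloring_def by metis
    have "distinguishing G d" "card (d ` pverts G) = j"
      using Q distinguishing_coloring_classes[OF assms(1)] unfolding d by auto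
    with uniq j have "Q = classes (pverts G) c" by (simp add: d classes_eq_iff)
    moreover then have "j = ?k"
      using Q unfolding distinguishing_coloring_def by (simp add: card_classes)
    ultimately show ?thesis by simp
  qed
  have dc: "distinguishing_coloring G ?k (classes (pverts G) c)"
    using c distinguishing_coloring_classes[OF assms(1)] by auto
  show k: "dist_chromatic_number G = ?k"
    unfolding dist_chromatic_number_def
  proof (rule Least_equality)
    show "\<exists>P. distinguishing_coloring G ?k P" using dc by blast
    show "?k \<le> j" if "\<exists>P. distinguishing_coloring G j P" for j
      using that eq by (metis nat_le_linear order_refl)
  qed
  show "uniquely_distinguishing_colorable G"
    unfolding uniquely_distinguishing_colorable_def k using dc eq by blast
  show "optimal_partition G = classes (pverts G) c"
    unfolding optimal_partition_def k
    by (rule the_equality[where P = "distinguishing_coloring G ?k", OF dc]) (use eq in blast)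
qed

lemma dominates_induce_iff:
  "u \<rightarrow>\<^bsub>with_proj G \<restriction> X\<^esub> v \<longleftrightarrow> (u, v) \<in> parcs G \<and> u \<in> X \<and> v \<in> X"
  by (auto simp: arcs_ends_conv image_iff intro: bexI[of _ "(u, v)"])

lemma graph_isomorphism_induce_iff:
  "graph_isomorphism f (with_proj G \<restriction> C) (with_proj H \<restriction> D) \<longleftrightarrow>
     bij_betw f C D \<and> (\<forall>u\<in>C. \<forall>v\<in>C. (u, v) \<in> parcs G \<longleftrightarrow> (f u, f v) \<in> parcs H)"
  unfolding graph_isomorphism_def dominates_induce_iff
  by (auto simp: bij_betw_apply)

text \<open>If \<open>f\<close> preserves the colours of \<open>c \<circ> s\<close>, then its
  conjugate by \<open>s\<close> preserves those of \<open>c\<close>. The conjugate is therefore the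
  identity, and so is \<open>f\<close>.\<close>

lemma distinguishing_comp_automorphism:
  assumes c: "distinguishing G c" and s: "graph_automorphism s G" and "pair_graph G"
  shows "distinguishing G (c \<circ> s)"
  unfolding distinguishing_def
proof (intro conjI allI impI)
  interpret pair_graph G by fact
  have b: "bij_betw s (pverts G) (pverts G)"
    and e: "\<And>u v. u \<in> pverts G \<Longrightarrow> v \<in> pverts G \<Longrightarrow> (u, v) \<in> parcs G \<longleftrightarrow> (s u, s v) \<in> parcs G"
    using s by (auto simp: graph_isomorphism_with_proj)
  show "(c \<circ> s) u \<noteq> (c \<circ> s) v" if "(u, v) \<in> parcs G" for u v
  proof -
    have "u \<in> pverts G" "v \<in> pverts G" using that arc_fst_in_verts arc_snd_in_verts by force+
    then have "(s u, s v) \<in> parcs G" using e that by blast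
    then show ?thesis using c by (simp add: distinguishing_def)
  qed
  fix f assume f: "graph_automorphism f G \<and> (\<forall>v\<in>pverts G. (c \<circ> s) (f v) = (c \<circ> s) v)"
  define t where "t = inv_into (pverts G) s"
  have t: "graph_automorphism t G"
    using graph_isomorphism_inv_into[OF s] by (simp add: t_def)
  have ts: "t (s v) = v" "s (t v) = v" "t v \<in> pverts G" "s v \<in> pverts G" if "v \<in> pverts G" for v
    using b that bij_betwE[OF b] by (auto simp: t_def bij_betw_def inv_into_into f_inv_into_f)
  have "graph_automorphism (s \<circ> (f \<circ> t)) G"
    using graph_isomorphism_comp[OF graph_isomorphism_comp[OF t] s] f by blast
  moreover have "c ((s \<circ> (f \<circ> t)) v) = c v" if "v \<in> pverts G" for v
    using f ts[OF that] by simp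
  ultimately have *: "s (f (t v)) = v" if "v \<in> pverts G" for v
    using c that unfolding distinguishing_def by auto
  show "\<forall>v\<in>pverts G. f v = v"
  proof
    fix v assume v: "v \<in> pverts G"
    then have fv: "f v \<in> pverts G" using f by (auto simp: graph_isomorphism_with_proj bij_betw_apply)
    have "s (f v) = s v" using *[of "s v"] ts[OF v] by simp
    then show "f v = v" using ts(1)[OF v] ts(1)[OF fv] by simp
  qed
qed

section \<open>Components, and automorphisms exchanging two of them\<close>

context pair_graph
begin

lemma arc_in_verts:
  assumes "(u, v) \<in> parcs G"
  shows "u \<in> pverts G" and "v \<in> pverts G"
  using assms arc_fst_in_verts arc_snd_in_verts by force+

lemma component_exists:
  assumes "v \<in> pverts G"
  obtains C where "C \<in> sccs_verts" "v \<in> C"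
  using assms scc_of_in_sccs_verts in_scc_of_self by blast

lemma component_eq: "C \<in> sccs_verts \<Longrightarrow> D \<in> sccs_verts \<Longrightarrow> v \<in> C \<Longrightarrow> v \<in> D \<Longrightarrow> C = D"
  using sccs_verts_disjoint by blast

lemma component_closed:
  assumes "C \<in> sccs_verts" and "u \<rightarrow>\<^sup>*\<^bsub>G\<^esub> v"
  shows "u \<in> C \<longleftrightarrow> v \<in> C"
proof -
  have "v \<rightarrow>\<^sup>*\<^bsub>G\<^esub> u" using assms(2) by (rule symmetric_reachable[OF sym_arcs])
  then show ?thesis
    using assms unfolding in_sccs_verts_conv_reachable by blast
qed

lemma component_arc:
  assumes "C \<in> sccs_verts" and "(u, v) \<in> parcs G"
  shows "u \<in> C \<longleftrightarrow> v \<in> C"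
  using assms component_closed reachable_adjI by blast

lemma component_nonempty: "C \<in> sccs_verts \<Longrightarrow> C \<noteq> {}"
  by (simp add: in_sccs_verts_conv_reachable)

text \<open>Arcs are symmetric, so connectivity and strong connectivity agree. This is why the
  strong components \<open>sccs_verts\<close> can serve as the components.\<close>

lemma connected_iff_component: "connected G \<longleftrightarrow> pverts G \<in> sccs_verts"
proof -
  have "connected G \<longleftrightarrow> strongly_connected G"
    unfolding connected_def strongly_connected_def
    using reachable_mk_symmetric_eq[OF sym_arcs] by simp
  also have "\<dots> \<longleftrightarrow> pverts G \<in> sccs_verts"
    unfolding strongly_connected_def in_sccs_verts_conv_reachable
    using reachable_in_verts by auto
  finally show ?thesis .
qed

abbreviation part_iso :: "('a \<Rightarrow> 'a) \<Rightarrow> 'a set \<Rightarrow> 'a set \<Rightarrow> bool" where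
  "part_iso f C D \<equiv> graph_isomorphism f (with_proj G \<restriction> C) (with_proj G \<restriction> D)"

lemma automorphism_reachable:
  assumes "graph_automorphism f G" and "u \<rightarrow>\<^sup>*\<^bsub>G\<^esub> v"
  shows "f u \<rightarrow>\<^sup>*\<^bsub>G\<^esub> f v"
  using assms(2)
proof (induction rule: reachable_induct)
  case base
  then show ?case using assms(1) by (auto simp: graph_isomorphism_with_proj bij_betw_apply)
next
  case (step x y)
  then have "(x, y) \<in> parcs G" by simp
  then have "(f x, f y) \<in> parcs G"
    using assms(1) arc_in_verts[of x y] unfolding graph_isomorphism_with_proj by blast
  then have "f x \<rightarrow>\<^bsub>G\<^esub> f y" by (simp only: with_proj_simps)
  show ?case by (rule reachable_adj_trans) fact+
qed

lemma automorphism_component: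
  assumes f: "graph_automorphism f G" and C: "C \<in> sccs_verts"
  shows "f ` C \<in> sccs_verts"
proof -
  obtain v where v: "v \<in> C" using component_nonempty[OF C] by blast
  have Cv: "C \<subseteq> pverts G" using C by (rule sccs_verts_subsets)
  have b: "bij_betw f (pverts G) (pverts G)" using f by (simp add: graph_isomorphism_with_proj)
  obtain D where D: "D \<in> sccs_verts" "f v \<in> D"
    using component_exists[OF bij_betw_apply[OF b subsetD[OF Cv v]]] .
  have "f ` C \<subseteq> D"
  proof
    fix y assume "y \<in> f ` C"
    then obtain x where x: "x \<in> C" "y = f x" by blast
    then have "v \<rightarrow>\<^sup>*\<^bsub>G\<^esub> x" using C v by (simp add: in_sccs_verts_conv_reachable)
    from automorphism_reachable[OF f this] show "y \<in> D"
      using component_closed[OF D(1)] D(2) x by blast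
  qed
  moreover have "D \<subseteq> f ` C"
  proof
    fix y assume y: "y \<in> D"
    then have r: "f v \<rightarrow>\<^sup>*\<^bsub>G\<^esub> y" using D by (simp add: in_sccs_verts_conv_reachable)
    \<comment> \<open>The inverse automorphism carries reachability from \<open>f v\<close> back to
      reachability from \<open>v\<close>, so the preimage of \<open>y\<close> lies in
      \<open>C\<close>.\<close>
    let ?g = "inv_into (pverts G) f"
    have g: "graph_automorphism ?g G" using graph_isomorphism_inv_into[OF f] by simp
    have "?g (f v) \<rightarrow>\<^sup>*\<^bsub>G\<^esub> ?g y" by (rule automorphism_reachable[OF g r])
    moreover have "?g (f v) = v" using b v Cv by (auto simp: bij_betw_def)
    ultimately have "?g y \<in> C" using component_closed[OF C] v by auto
    moreover have "y \<in> pverts G" using y D sccs_verts_subsets by blast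
    then have "f (?g y) = y" using b by (simp add: bij_betw_def f_inv_into_f)
    ultimately show "y \<in> f ` C" by (metis imageI)
  qed
  ultimately show ?thesis using D by (simp add: subset_antisym)
qed

definition swap_parts :: "'a set \<Rightarrow> 'a set \<Rightarrow> ('a \<Rightarrow> 'a) \<Rightarrow> 'a \<Rightarrow> 'a" where
  "swap_parts C D f v = (if v \<in> C then f v else if v \<in> D then inv_into C f v else v)"

lemma swap_parts_automorphism:
  assumes C: "C \<in> sccs_verts" and D: "D \<in> sccs_verts" and f: "part_iso f C D"
  shows "graph_automorphism (swap_parts C D f) G"
proof -
  let ?s = "swap_parts C D f"
  have b: "bij_betw f C D" using f by (simp add: graph_isomorphism_induce_iff)
  have g: "part_iso (inv_into C f) D C"
    using graph_isomorphism_inv_into[OF f] by simp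
  have sub: "C \<subseteq> pverts G" "D \<subseteq> pverts G" using C D sccs_verts_subsets by blast+
  have fC: "?s v \<in> D" "inv_into C f (f v) = v" if "v \<in> C" for v
    using that b by (auto simp: swap_parts_def bij_betw_def)
  have fD: "?s v \<in> C" "f (inv_into C f v) = v" if "v \<in> D" "v \<notin> C" for v
    using that b by (auto simp: swap_parts_def bij_betw_def inv_into_into f_inv_into_f)
  have disj: "C = D \<or> C \<inter> D = {}" using C D sccs_verts_disjoint by blast
  have s_verts: "?s v \<in> pverts G" if "v \<in> pverts G" for v
    using that fC fD sub by (cases "v \<in> C"; cases "v \<in> D") (auto simp: swap_parts_def)
  have img: "v \<in> ?s ` pverts G" if v: "v \<in> pverts G" for v
  proof (cases "v \<in> D")
    case True
    then have "inv_into C f v \<in> C" "f (inv_into C f v) = v"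
      using b by (auto simp: bij_betw_def inv_into_into f_inv_into_f)
    then show ?thesis using sub by (intro image_eqI[of _ _ "inv_into C f v"]) (auto simp: swap_parts_def)
  next
    case False
    show ?thesis
    proof (cases "v \<in> C")
      case True
      then have "f v \<in> D" using b by (auto simp: bij_betw_def)
      moreover have "f v \<notin> C" using True False disj \<open>f v \<in> D\<close> by auto
      ultimately show ?thesis
        using True sub fC(2)[OF True] by (intro image_eqI[of _ _ "f v"]) (auto simp: swap_parts_def)
    next
      case False
      then show ?thesis using v \<open>v \<notin> D\<close> by (intro image_eqI[of _ _ v]) (auto simp: swap_parts_def)
    qed
  qed
  have "?s ` pverts G = pverts G" using img s_verts by blast
  then have bs: "bij_betw ?s (pverts G) (pverts G)"
    using pair_finite_verts by (simp add: bij_betw_def eq_card_imp_inj_on)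
  have inside: "(u, v) \<in> parcs G \<longleftrightarrow> (?s u, ?s v) \<in> parcs G"
    if "u \<in> C \<and> v \<in> C \<or> u \<in> D - C \<and> v \<in> D - C \<or> u \<notin> C \<union> D \<and> v \<notin> C \<union> D" for u v
    using that f g unfolding graph_isomorphism_induce_iff swap_parts_def by auto
  have "(u, v) \<in> parcs G \<longleftrightarrow> (?s u, ?s v) \<in> parcs G"
    if uv: "u \<in> pverts G" "v \<in> pverts G" for u v
  proof (cases "(u \<in> C \<longleftrightarrow> v \<in> C) \<and> (u \<in> D \<longleftrightarrow> v \<in> D)")
    case True
    then show ?thesis using inside by blast
  next
    case False
    then have "(u, v) \<notin> parcs G" using component_arc C D by blast
    \<comment> \<open>\<open>?s\<close> interchanges membership in \<open>C\<close> and in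
      \<open>D\<close>. Since \<open>C\<close> or \<open>D\<close> separates \<open>u\<close> from
      \<open>v\<close>, one of them also separates the images, which are then not joined by an
      arc.\<close>
    moreover have sc: "?s w \<in> D \<longleftrightarrow> w \<in> C" "?s w \<in> C \<longleftrightarrow> w \<in> D" for w
      using disj fC fD by (cases "w \<in> C"; cases "w \<in> D"; auto simp: swap_parts_def)+
    have "(?s u, ?s v) \<notin> parcs G"
      using False component_arc[OF C, of "?s u" "?s v"] component_arc[OF D, of "?s u" "?s v"]
      unfolding sc by blast
    ultimately show ?thesis by simp
  qed
  then show ?thesis using bs by (simp add: graph_isomorphism_with_proj)
qed

text \<open>A coloured isomorphism between two components extends to a coloured automorphism by
  \<open>swap_parts\<close>; conversely, a coloured automorphism restricts to such isomorphisms. For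
  distinct components, which are disjoint, the condition says that they are not isomorphic as
  coloured graphs.\<close>

lemma distinguishing_iff_components:
  "distinguishing G c \<longleftrightarrow>
     (\<forall>u v. (u, v) \<in> parcs G \<longrightarrow> c u \<noteq> c v) \<and>
     (\<forall>C\<in>sccs_verts. \<forall>D\<in>sccs_verts. \<forall>f.
        part_iso f C D \<and> (\<forall>v\<in>C. c (f v) = c v) \<longrightarrow> (\<forall>v\<in>C. f v = v))"
proof -
  have 1: "f v = v"
    if c: "distinguishing G c" and CD: "C \<in> sccs_verts" "D \<in> sccs_verts"
      and f: "part_iso f C D" "\<forall>v\<in>C. c (f v) = c v" and v: "v \<in> C" for C D f v
  proof -
    let ?s = "swap_parts C D f"
    have b: "bij_betw f C D" using f by (simp add: graph_isomorphism_induce_iff)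
    have "c (?s w) = c w" for w
    proof (cases "w \<in> D - C")
      case True
      then have "inv_into C f w \<in> C" "f (inv_into C f w) = w"
        using b by (auto simp: bij_betw_def inv_into_into f_inv_into_f)
      then show ?thesis using True f(2) by (metis DiffD1 DiffD2 swap_parts_def)
    next
      case False
      then show ?thesis using f(2) by (auto simp: swap_parts_def)
    qed
    moreover have "graph_automorphism ?s G"
      by (rule swap_parts_automorphism[OF CD f(1)])
    moreover have "v \<in> pverts G" using v CD sccs_verts_subsets by blast
    ultimately have "?s v = v" using c unfolding distinguishing_def by blast
    then show "f v = v" using v by (simp add: swap_parts_def)
  qed
  have 2: "f v = v"
    if c: "\<forall>C\<in>sccs_verts. \<forall>D\<in>sccs_verts. \<forall>f.
        part_iso f C D \<and> (\<forall>v\<in>C. c (f v) = c v) \<longrightarrow> (\<forall>v\<in>C. f v = v)"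
      and f: "graph_automorphism f G" "\<forall>v\<in>pverts G. c (f v) = c v" and v: "v \<in> pverts G" for f v
  proof -
    obtain C where C: "C \<in> sccs_verts" "v \<in> C" using v component_exists by blast
    then have sub: "C \<subseteq> pverts G" using sccs_verts_subsets by blast
    have "part_iso f C (f ` C)"
      using f(1) sub unfolding graph_isomorphism_induce_iff graph_isomorphism_with_proj
      by (auto simp: bij_betw_def intro: inj_on_subset)
    moreover have "f ` C \<in> sccs_verts" using automorphism_component f(1) C(1) by blast
    moreover have "\<forall>v\<in>C. c (f v) = c v" using f(2) sub by blast
    ultimately show ?thesis using c C by blast
  qed
  show ?thesis
  proof
    assume "distinguishing G c"
    then show "(\<forall>u v. (u, v) \<in> parcs G \<longrightarrow> c u \<noteq> c v) \<and>
     (\<forall>C\<in>sccs_verts. \<forall>D\<in>sccs_verts. \<forall>f.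
        part_iso f C D \<and> (\<forall>v\<in>C. c (f v) = c v) \<longrightarrow> (\<forall>v\<in>C. f v = v))"
      using 1 by (auto simp: distinguishing_def)
  next
    assume *: "(\<forall>u v. (u, v) \<in> parcs G \<longrightarrow> c u \<noteq> c v) \<and>
     (\<forall>C\<in>sccs_verts. \<forall>D\<in>sccs_verts. \<forall>f.
        part_iso f C D \<and> (\<forall>v\<in>C. c (f v) = c v) \<longrightarrow> (\<forall>v\<in>C. f v = v))"
    show "distinguishing G c"
      unfolding distinguishing_def using * 2[OF conjunct2[OF *]] by simp
  qed
qed

end

section \<open>Recolourings of a disconnected uniquely colourable graph\<close>

locale disconnected_udc_graph = pair_graph G for G :: "'a pair_pre_digraph" +
  fixes c :: "'a \<Rightarrow> nat"
  assumes has_edge: "parcs G \<noteq> {}"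
    and disconnected: "\<not> connected G"
    and dist: "distinguishing G c"
    and unique: "\<And>d :: 'a \<Rightarrow> nat. distinguishing G d \<Longrightarrow>
      card (d ` pverts G) \<le> card (c ` pverts G) \<Longrightarrow> same_classes (pverts G) d c"
begin

lemma unique_subset:
  fixes d :: "'a \<Rightarrow> nat"
  assumes "distinguishing G d" and "d ` pverts G \<subseteq> c ` pverts G"
  shows "same_classes (pverts G) d c"
  using assms by (intro unique card_mono) (simp_all add: pair_finite_verts)

lemma component_subset: "C \<in> sccs_verts \<Longrightarrow> C \<subseteq> pverts G"
  by (rule sccs_verts_subsets)

lemma proper: "(u, v) \<in> parcs G \<Longrightarrow> c u \<noteq> c v"
  using dist by (simp add: distinguishing_def)

lemma colored_iso_trivial:
  assumes "C \<in> sccs_verts" "D \<in> sccs_verts" "part_iso f C D" "\<And>v. v \<in> C \<Longrightarrow> c (f v) = c v"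
    and "v \<in> C"
  shows "f v = v"
  using dist assms unfolding distinguishing_iff_components by blast

text \<open>A coloured isomorphism fixes every vertex, so its domain and its image meet.\<close>

lemma colored_iso_same_component:
  assumes C: "C \<in> sccs_verts" and D: "D \<in> sccs_verts" and f: "part_iso f C D"
    and pres: "\<And>v. v \<in> C \<Longrightarrow> c (f v) = c v"
  shows "C = D"
proof -
  obtain v where v: "v \<in> C" using component_nonempty[OF C] by blast
  have "f v \<in> D" using f v by (auto simp: graph_isomorphism_induce_iff bij_betw_def)
  then have "v \<in> D" using colored_iso_trivial[OF C D f pres v] by simp
  then show ?thesis using component_eq[OF C D v] by simp
qed

lemma part_iso_inv:
  "part_iso f C D \<Longrightarrow> part_iso (inv_into C f) D C"
  using graph_isomorphism_inv_into[of f "with_proj G \<restriction> C" "with_proj G \<restriction> D"] by simp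

lemma part_iso_inv_into:
  assumes "part_iso f C D" and "v \<in> D"
  shows "inv_into C f v \<in> C" and "f (inv_into C f v) = v"
  using assms by (auto simp: graph_isomorphism_induce_iff bij_betw_def inv_into_into f_inv_into_f)

lemma part_iso_apply: "part_iso f C D \<Longrightarrow> v \<in> C \<Longrightarrow> f v \<in> D"
  by (auto simp: graph_isomorphism_induce_iff bij_betw_def)

text \<open>A transposition is injective on colours, so it keeps the labelling proper on unions of
  components and does not alter which maps within \<open>X\<close> preserve colours.\<close>

definition recolor :: "'a set \<Rightarrow> nat \<Rightarrow> nat \<Rightarrow> 'a \<Rightarrow> nat" where
  "recolor X a b v = (if v \<in> X then transpose a b (c v) else c v)"

lemma recolor_subset:
  assumes "a \<in> c ` pverts G" "b \<in> c ` pverts G"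
  shows "recolor X a b ` pverts G \<subseteq> c ` pverts G"
  using assms by (auto simp: recolor_def transpose_def)

text \<open>A vertex of colour \<open>a\<close> inside \<open>X\<close> receives colour
  \<open>b\<close> and joins the class of a vertex outside \<open>X\<close> that had another colour
  before. The classes change without a new colour, against uniqueness.\<close>

lemma recolor_not_distinguishing:
  assumes X: "X \<subseteq> pverts G" and a: "a \<in> c ` X" and b: "b \<in> c ` (pverts G - X)" and "a \<noteq> b"
  shows "\<not> distinguishing G (recolor X a b)"
proof
  assume "distinguishing G (recolor X a b)"
  moreover have "recolor X a b ` pverts G \<subseteq> c ` pverts G"
    using a b X by (intro recolor_subset) auto
  ultimately have s: "same_classes (pverts G) (recolor X a b) c" by (rule unique_subset)
  obtain x y where x: "x \<in> X" "a = c x" and y: "y \<in> pverts G - X" "b = c y" using a b by blast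
  then have "recolor X a b x = recolor X a b y" by (simp add: recolor_def)
  then have "c x = c y" using s x y X unfolding same_classes_def by blast
  then show False using \<open>a \<noteq> b\<close> x y by simp
qed

lemma recolor_proper:
  assumes X: "\<And>u v. (u, v) \<in> parcs G \<Longrightarrow> u \<in> X \<longleftrightarrow> v \<in> X" and uv: "(u, v) \<in> parcs G"
  shows "recolor X a b u \<noteq> recolor X a b v"
  using X[OF uv] proper[OF uv] by (auto simp: recolor_def transpose_eq_iff)

text \<open>Let \<open>X\<close> be the union of the components isomorphic to \<open>C\<close>. An
  isomorphism between components stays inside \<open>X\<close> or stays outside it, so transposing
  two colours on \<open>X\<close> alone creates no coloured isomorphism; yet such a recolouring
  cannot be distinguishing if \<open>D\<close> lies outside \<open>X\<close>.\<close>

lemma components_isomorphic: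
  assumes C: "C \<in> sccs_verts" and D: "D \<in> sccs_verts"
  shows "\<exists>f. part_iso f C D"
proof (rule ccontr)
  assume D_not: "\<nexists>f. part_iso f C D"
  define X where "X = \<Union>{E \<in> sccs_verts. \<exists>f. part_iso f C E}"
  have inX: "v \<in> X \<longleftrightarrow> (\<exists>f. part_iso f C E)" if E: "E \<in> sccs_verts" "v \<in> E" for E v
    using component_eq[OF E(1) _ E(2)] E unfolding X_def by blast
  have "part_iso id C C" by (auto simp: graph_isomorphism_induce_iff)
  then have CX: "C \<subseteq> X" using inX[OF C] by blast
  have DX: "D \<inter> X = {}" using inX[OF D] D_not by blast
  have XV: "X \<subseteq> pverts G" unfolding X_def using component_subset by blast
  obtain x y where x: "x \<in> X" and y: "y \<in> pverts G - X"
    using component_nonempty[OF C] component_nonempty[OF D] CX DX component_subset[OF D] by blast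
  obtain u v where uv: "(u, v) \<in> parcs G" using has_edge by auto
  \<comment> \<open>If the chosen vertices \<open>x\<close> and \<open>y\<close> share their colour,
    an edge still supplies a vertex \<open>w\<close> of another colour, which is paired with
    \<open>y\<close> or with \<open>x\<close> according to its side.\<close>
  have "\<exists>a\<in>c ` X. \<exists>b\<in>c ` (pverts G - X). a \<noteq> b"
  proof (cases "c x = c y")
    case True
    obtain w where w: "w \<in> pverts G" "c w \<noteq> c x"
      using proper[OF uv] arc_in_verts[OF uv] by metis
    show ?thesis
    proof (cases "w \<in> X")
      case True
      then show ?thesis
        using w \<open>c x = c y\<close> y by (intro bexI[of _ "c w"] bexI[of _ "c y"]) auto
    next
      case False
      then show ?thesis
        using w x by (intro bexI[of _ "c x"] bexI[of _ "c w"]) auto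
    qed
  qed (use x y in blast)
  then obtain a b where ab: "a \<in> c ` X" "b \<in> c ` (pverts G - X)" "a \<noteq> b" by blast
  have X_closed: "p \<in> X \<longleftrightarrow> q \<in> X" if "(p, q) \<in> parcs G" for p q
    using component_arc[OF _ that] unfolding X_def by blast
  have "distinguishing G (recolor X a b)"
    unfolding distinguishing_iff_components
  proof (intro conjI allI ballI impI)
    show "recolor X a b p \<noteq> recolor X a b q" if "(p, q) \<in> parcs G" for p q
      using X_closed that by (rule recolor_proper)
    fix E F f v
    assume E: "E \<in> sccs_verts" and F: "F \<in> sccs_verts"
      and f: "part_iso f E F \<and> (\<forall>v\<in>E. recolor X a b (f v) = recolor X a b v)" and v: "v \<in> E"
    have "c (f p) = c p" if p: "p \<in> E" for p
    proof -
      have fp: "f p \<in> F" using f p part_iso_apply by blast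
      have "(\<exists>g. part_iso g C E) \<longleftrightarrow> (\<exists>g. part_iso g C F)"
        using graph_isomorphism_comp[of _ "with_proj G \<restriction> C"] f part_iso_inv by blast
      then have "p \<in> X \<longleftrightarrow> f p \<in> X" using inX[OF E p] inX[OF F fp] by simp
      moreover have "recolor X a b (f p) = recolor X a b p" using f p by blast
      ultimately show ?thesis by (auto simp: recolor_def transpose_eq_iff split: if_splits)
    qed
    then show "f v = v" using colored_iso_trivial[OF E F] f v by blast
  qed
  then show False using recolor_not_distinguishing[OF XV ab] by blast
qed

text \<open>The recolouring is not distinguishing, so it admits a nontrivial coloured isomorphism
  from a component \<open>E\<close> onto a component \<open>F\<close>. If both or neither were
  \<open>C\<close>, it would preserve \<open>c\<close> and be trivial. So exactly one is
  \<open>C\<close>, and \<open>f\<close> or its inverse is as required.\<close>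

lemma recolored_component_isomorphic:
  assumes C: "C \<in> sccs_verts" and a: "a \<in> c ` C" and b: "b \<in> c ` (pverts G - C)" and "a \<noteq> b"
  obtains D f where "D \<in> sccs_verts" "D \<noteq> C" "part_iso f C D"
    "\<And>v. v \<in> C \<Longrightarrow> c (f v) = transpose a b (c v)"
proof -
  let ?r = "recolor C a b"
  have "\<not> distinguishing G ?r"
    using recolor_not_distinguishing component_subset assms by blast
  moreover have "?r u \<noteq> ?r v" if "(u, v) \<in> parcs G" for u v
    using component_arc[OF C] that by (rule recolor_proper)
  ultimately obtain E F f w where E: "E \<in> sccs_verts" and F: "F \<in> sccs_verts"
    and f: "part_iso f E F" and rf: "\<And>v. v \<in> E \<Longrightarrow> ?r (f v) = ?r v" and w: "w \<in> E" "f w \<noteq> w"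
    unfolding distinguishing_iff_components by blast
  have in_C: "K = C" if "K \<in> sccs_verts" "v \<in> C" "v \<in> K" for v K
    using component_eq[OF that(1) C that(3) that(2)] .
  have neq: "\<exists>v\<in>E. c (f v) \<noteq> c v"
    using colored_iso_trivial[OF E F f _ w(1)] w(2) by blast
  show thesis
  proof (cases "E = C")
    case True
    have "F \<noteq> C"
    proof
      assume "F = C"
      then have "c (f v) = c v" if "v \<in> E" for v
        using rf[OF that] part_iso_apply[OF f that] that True
        by (auto simp: recolor_def transpose_eq_iff)
      then show False using neq by blast
    qed
    moreover have "c (f v) = transpose a b (c v)" if "v \<in> C" for v
    proof -
      have "f v \<in> F" using part_iso_apply[OF f] that True by blast
      then have "f v \<notin> C" using in_C[OF F] \<open>F \<noteq> C\<close> by blast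
      then show ?thesis using rf[of v] that True by (simp add: recolor_def)
    qed
    ultimately show thesis using that F f True by blast
  next
    case False
    then have EC: "v \<notin> C" if "v \<in> E" for v using in_C[OF E] that by blast
    have "F = C"
    proof (rule ccontr)
      assume "F \<noteq> C"
      then have "f v \<notin> C" if "v \<in> E" for v
        using in_C[OF F] part_iso_apply[OF f that] by blast
      then have "c (f v) = c v" if "v \<in> E" for v
        using rf[OF that] EC[OF that] that by (simp add: recolor_def)
      then show False using neq by blast
    qed
    have "c (inv_into E f v) = transpose a b (c v)" if v: "v \<in> C" for v
    proof -
      have "inv_into E f v \<in> E" "f (inv_into E f v) = v"
        using part_iso_inv_into[OF f] v \<open>F = C\<close> by blast+
      then show ?thesis using rf[of "inv_into E f v"] EC v by (simp add: recolor_def)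
    qed
    moreover have "part_iso (inv_into E f) C E" using part_iso_inv[OF f] \<open>F = C\<close> by simp
    ultimately show thesis using that E False by blast
  qed
qed

text \<open>As all components are isomorphic, an edge in one of them is carried to every
  other.\<close>

lemma component_edge:
  assumes C: "C \<in> sccs_verts"
  obtains u v where "u \<in> C" "v \<in> C" "(u, v) \<in> parcs G"
proof -
  obtain u v where uv: "(u, v) \<in> parcs G" using has_edge by auto
  obtain D where D: "D \<in> sccs_verts" "u \<in> D"
    using component_exists[OF arc_in_verts(1)[OF uv]] .
  then have "v \<in> D" using component_arc[OF D(1) uv] by simp
  moreover obtain f where f: "part_iso f D C" using components_isomorphic[OF D(1) C] by blast
  ultimately have "(f u, f v) \<in> parcs G" "f u \<in> C" "f v \<in> C"
    using D(2) uv by (auto simp: graph_isomorphism_induce_iff bij_betw_def)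
  then show thesis by (intro that)
qed

lemma component_other_color:
  assumes C: "C \<in> sccs_verts"
  obtains b where "b \<in> c ` C" "b \<noteq> a"
proof -
  obtain u v where "u \<in> C" "v \<in> C" "(u, v) \<in> parcs G" by (rule component_edge[OF C])
  then show thesis using proper[of u v] that by (metis imageI)
qed

text \<open>
  Exchange another colour \<open>x\<close> of \<open>C\<close> with a colour \<open>b\<close> of
  \<open>D\<close>: the recoloured \<open>C\<close> still has the colour \<open>a\<close>, but it is
  isomorphic to a component other than \<open>C\<close>.
\<close>

lemma no_exclusive_color:
  assumes C: "C \<in> sccs_verts" and D: "D \<in> sccs_verts" and CD: "C \<noteq> D" and a: "a \<in> c ` C"
  shows "a \<in> c ` (pverts G - C)"
proof (rule ccontr)
  assume excl: "a \<notin> c ` (pverts G - C)"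
  obtain x where x: "x \<in> c ` C" "x \<noteq> a" using component_other_color[OF C] by blast
  obtain b where b: "b \<in> c ` D" "b \<noteq> x" using component_other_color[OF D] by blast
  have rest: "E \<subseteq> pverts G - C" if "E \<in> sccs_verts" "E \<noteq> C" for E
    using that C sccs_verts_disjoint component_subset by blast
  have b': "b \<in> c ` (pverts G - C)" using b rest[OF D] CD by blast
  then have "b \<noteq> a" using excl by blast
  obtain E f where E: "E \<in> sccs_verts" "E \<noteq> C" "part_iso f C E"
    and cf: "\<And>v. v \<in> C \<Longrightarrow> c (f v) = transpose x b (c v)"
    using recolored_component_isomorphic[OF C x(1) b'] b(2) by blast
  obtain v where v: "v \<in> C" "a = c v" using a by blast
  then have "c (f v) = a" using cf[OF v(1)] x(2) \<open>b \<noteq> a\<close> by simp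
  moreover have "f v \<in> pverts G - C" using part_iso_apply[OF E(3) v(1)] rest[OF E(1,2)] by blast
  ultimately show False using excl by blast
qed

text \<open>The swap carries the unique partition to a distinguishing one with no new colours, hence
  to itself; it may permute the classes.\<close>

lemma same_classes_swap:
  assumes "C \<in> sccs_verts" "D \<in> sccs_verts" "part_iso f C D"
  shows "same_classes (pverts G) (c \<circ> swap_parts C D f) c"
proof (rule unique_subset)
  have a: "graph_automorphism (swap_parts C D f) G" by (rule swap_parts_automorphism[OF assms])
  show "distinguishing G (c \<circ> swap_parts C D f)"
    by (rule distinguishing_comp_automorphism[OF dist a]) (rule pair_graph)
  show "(c \<circ> swap_parts C D f) ` pverts G \<subseteq> c ` pverts G"
    using a by (auto simp: graph_isomorphism_with_proj bij_betw_def)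
qed

text \<open>On \<open>C\<close> the swap is \<open>f\<close>. So \<open>c \<circ> f\<close> is a
  second labelling of the same partition of \<open>C\<close>, which is what the argument for type 2
  compares with \<open>c\<close>.\<close>

lemma same_classes_iso:
  assumes "C \<in> sccs_verts" "D \<in> sccs_verts" "part_iso f C D"
  shows "same_classes C (c \<circ> f) c"
proof -
  have "(c \<circ> swap_parts C D f) u = (c \<circ> f) u" if "u \<in> C" for u
    using that by (simp add: swap_parts_def)
  then show ?thesis
    using same_classes_swap[OF assms] component_subset[OF assms(1)]
    unfolding same_classes_def by (metis subsetD)
qed

text \<open>The swap fixes \<open>w\<close> and sends \<open>u\<close> to \<open>f u\<close>. If
  \<open>w\<close> and \<open>u\<close> were in one class, they would remain so after the swap,
  giving \<open>c (f u) = c w = c u\<close>.\<close>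

lemma moved_color_not_outside:
  assumes C: "C \<in> sccs_verts" and D: "D \<in> sccs_verts" and f: "part_iso f C D"
    and u: "u \<in> C" "c (f u) \<noteq> c u" and w: "w \<in> pverts G" "w \<notin> C" "w \<notin> D"
  shows "c w \<noteq> c u"
proof
  assume eq: "c w = c u"
  have "u \<in> pverts G" using u component_subset[OF C] by blast
  then have "(c \<circ> swap_parts C D f) w = (c \<circ> swap_parts C D f) u"
    using same_classes_swap[OF C D f] w(1) eq unfolding same_classes_def by blast
  then show False using u w eq by (simp add: swap_parts_def)
qed

lemma two_components:
  obtains C D where "C \<in> sccs_verts" "D \<in> sccs_verts" "C \<inter> D = {}" "C \<union> D = pverts G"
proof -
  obtain x where x: "x \<in> pverts G" using has_edge arc_in_verts by auto
  obtain C where C: "C \<in> sccs_verts" "x \<in> C" using component_exists[OF x] .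
  then have "C \<noteq> pverts G" using disconnected connected_iff_component by blast
  then obtain y where y: "y \<in> pverts G" "y \<notin> C" using component_subset[OF C(1)] by blast
  obtain D where D: "D \<in> sccs_verts" "y \<in> D" using component_exists[OF y(1)] .
  have CD: "C \<noteq> D" using y D by blast
  have "z \<in> C \<union> D" if z: "z \<in> pverts G" for z
  proof (rule ccontr)
    assume nz: "z \<notin> C \<union> D"
    obtain F where F: "F \<in> sccs_verts" "z \<in> F" using component_exists[OF z] .
    have CF: "C \<noteq> F" and DF: "D \<noteq> F" using F nz by blast+
    have disj: "D \<inter> F = {}" using sccs_verts_disjoint D F DF by blast
    obtain f where f: "part_iso f C D" using components_isomorphic[OF C(1) D(1)] by blast
    obtain g where g: "part_iso g C F" using components_isomorphic[OF C(1) F(1)] by blast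
    \<comment> \<open>Such a \<open>u\<close> exists because \<open>f\<close> would otherwise be a
      coloured isomorphism between distinct components.\<close>
    obtain u where u: "u \<in> C" "c (f u) \<noteq> c u"
      using colored_iso_same_component[OF C(1) D(1) f] CD by blast
    have gu: "g u \<in> F" by (rule part_iso_apply[OF g u(1)])
    have "g u \<in> pverts G" "g u \<notin> C" "g u \<notin> D"
      using gu component_subset[OF F(1)] component_eq[OF C(1) F(1)] CF disj by blast+
    then have "c (g u) \<noteq> c u" by (rule moved_color_not_outside[OF C(1) D(1) f u])
    \<comment> \<open>Now \<open>g\<close> moves the colour of \<open>u\<close> as well. The colour
      is thus absent outside \<open>C \<union> D\<close> and outside \<open>C \<union> F\<close>; as
      \<open>D\<close> and \<open>F\<close> are disjoint, it is absent everywhere outside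
      \<open>C\<close>.\<close>
    then have "c w \<noteq> c u" if "w \<in> pverts G" "w \<notin> C" for w
      using moved_color_not_outside[OF C(1) D(1) f u that]
        moved_color_not_outside[OF C(1) F(1) g u(1) _ that] disj by blast
    then have "c u \<notin> c ` (pverts G - C)" by (auto dest: sym)
    then show False
      using no_exclusive_color[OF C(1) D(1) CD] u(1) by blast
  qed
  moreover have "C \<inter> D = {}" using sccs_verts_disjoint C D CD by blast
  moreover have "C \<union> D \<subseteq> pverts G" using component_subset C D by blast
  ultimately show thesis using that C D by blast
qed

lemma all_colors_in_component:
  assumes C: "C \<in> sccs_verts" and D: "D \<in> sccs_verts" and CD: "C \<inter> D = {}" "C \<union> D = pverts G"
  shows "c ` C = c ` pverts G"
proof -
  have neq: "C \<noteq> D" using CD component_nonempty[OF C] by blast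
  have "pverts G - D = C" using CD by blast
  then have "c ` D \<subseteq> c ` C"
    using no_exclusive_color[OF D C] neq by auto
  then show ?thesis using CD(2) by blast
qed

end

section \<open>Components as graphs of their own, and labelings of two copies\<close>

definition pair_induce :: "'a pair_pre_digraph \<Rightarrow> 'a set \<Rightarrow> 'a pair_pre_digraph" where
  "pair_induce G C = \<lparr> pverts = C, parcs = {e \<in> parcs G. fst e \<in> C \<and> snd e \<in> C} \<rparr>"

text \<open>The induced subgraph of the library is a general digraph, while the colouring notions
  concern pair digraphs. This equation passes between the two.\<close>

lemma with_proj_pair_induce: "with_proj (pair_induce G C) = with_proj G \<restriction> C"
  by (simp add: with_proj_def induce_subgraph_def pair_induce_def)

lemma pverts_pair_induce [simp]: "pverts (pair_induce G C) = C"
  by (simp add: pair_induce_def)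

lemma parcs_pair_induce: "(u, v) \<in> parcs (pair_induce G C) \<longleftrightarrow> (u, v) \<in> parcs G \<and> u \<in> C \<and> v \<in> C"
  by (simp add: pair_induce_def)

lemma (in pair_graph) pair_graph_pair_induce:
  assumes "C \<subseteq> pverts G"
  shows "pair_graph (pair_induce G C)"
proof
  show "finite (pverts (pair_induce G C))"
    using assms pair_finite_verts by (auto intro: finite_subset)
  show "finite (parcs (pair_induce G C))"
    using pair_finite_arcs by (auto simp: pair_induce_def)
  show "fst e \<noteq> snd e" if "e \<in> parcs (pair_induce G C)" for e
    using that pair_no_loops by (auto simp: pair_induce_def)
  show "symmetric (pair_induce G C)"
    using arcs_symmetric by (auto simp: symmetric_def parcs_pair_induce intro!: symI)
qed (auto simp: pair_induce_def)

lemma (in pair_graph) connected_pair_induce: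
  assumes C: "C \<in> sccs_verts"
  shows "connected (pair_induce G C)"
proof -
  interpret H: pair_graph "pair_induce G C"
    using pair_graph_pair_induce[OF sccs_verts_subsets[OF C]] .
  interpret max_reachable_set "with_proj G" C
    using C by unfold_locales
  have "C \<in> H.sccs_verts"
    unfolding H.in_sccs_verts_conv_reachable
  proof (intro conjI ballI allI impI)
    show "C \<noteq> {}" by (rule not_empty)
    show "u \<rightarrow>\<^sup>*\<^bsub>pair_induce G C\<^esub> v" if "u \<in> C" "v \<in> C" for u v
      unfolding with_proj_pair_induce using that reach_in by (intro reachable_induced)
    show "\<not> u \<rightarrow>\<^sup>*\<^bsub>pair_induce G C\<^esub> v \<or> \<not> v \<rightarrow>\<^sup>*\<^bsub>pair_induce G C\<^esub> u" if "u \<in> C" "v \<notin> C" for u v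
      using that H.reachable_in_verts(2)[of u v] by auto
  qed
  then show ?thesis using H.connected_iff_component by simp
qed

text \<open>Any bijection \<open>h\<close> from colours to labels gives a class labeling through the
  colour of a class. The label of a vertex is then computed from its colour, without the definite
  description in \<open>vertex_label\<close>.\<close>

lemma vertex_label_classes:
  assumes "optimal_partition G = classes (pverts G) c" and "v \<in> pverts G"
  shows "vertex_label G (\<lambda>X. h (the_elem (c ` X))) v = h (c v)"
proof -
  have "(THE C. C \<in> optimal_partition G \<and> v \<in> C) = {u \<in> pverts G. c u = c v}"
    using assms by (intro the_equality) (auto simp: classes_def)
  moreover have "c ` {u \<in> pverts G. c u = c v} = {c v}" using assms(2) by auto
  ultimately show ?thesis by (simp add: vertex_label_def)
qed

lemma class_labeling_classes:
  assumes "optimal_partition G = classes (pverts G) c"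
    and "bij_betw h (c ` pverts G) {1..dist_chromatic_number G}"
  shows "class_labeling G (\<lambda>X. h (the_elem (c ` X)))"
  using bij_betw_trans[OF bij_betw_classes assms(2)] assms(1)
  by (simp add: class_labeling_def comp_def)

lemma parcs_disjoint_union [simp]:
  "(Inl u, Inl v) \<in> parcs (disjoint_union G H) \<longleftrightarrow> (u, v) \<in> parcs G"
  "(Inr x, Inr y) \<in> parcs (disjoint_union G H) \<longleftrightarrow> (x, y) \<in> parcs H"
  "(Inl u, Inr y) \<notin> parcs (disjoint_union G H)"
  "(Inr x, Inl v) \<notin> parcs (disjoint_union G H)"
  by (auto simp: disjoint_union_def)

lemma pverts_disjoint_union [simp]: "pverts (disjoint_union G H) = pverts G <+> pverts H"
  by (simp add: disjoint_union_def)

lemma pair_wf_digraph_disjoint_union: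
  assumes "pair_wf_digraph G" and "pair_wf_digraph H"
  shows "pair_wf_digraph (disjoint_union G H)"
proof -
  interpret G: pair_wf_digraph G by fact
  interpret H: pair_wf_digraph H by fact
  show ?thesis
  proof
    fix e assume e: "e \<in> parcs (disjoint_union G H)"
    then consider a where "a \<in> parcs G" "e = map_prod Inl Inl a"
      | a where "a \<in> parcs H" "e = map_prod Inr Inr a"
      by (auto simp: disjoint_union_def)
    then have "fst e \<in> pverts (disjoint_union G H) \<and> snd e \<in> pverts (disjoint_union G H)"
    proof cases
      case 1
      then show ?thesis
        using G.arc_fst_in_verts[OF 1(1)] G.arc_snd_in_verts[OF 1(1)] by (simp add: InlI InrI)
    next
      case 2
      then show ?thesis
        using H.arc_fst_in_verts[OF 2(1)] H.arc_snd_in_verts[OF 2(1)] by (simp add: InlI InrI)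
    qed
    then show "fst e \<in> pverts (disjoint_union G H)" "snd e \<in> pverts (disjoint_union G H)"
      by simp_all
  qed
qed

text \<open>Stripping the injections from the isomorphism between the two copies leaves an
  automorphism of \<open>G\<close> that carries one labeling to the other.\<close>

lemma type_1_isomorphism:
  assumes "type_1 G" and "class_labeling G l" and "class_labeling G m"
  obtains t where "graph_automorphism t G"
    "\<forall>v\<in>pverts G. vertex_label G m (t v) = vertex_label G l v"
proof -
  let ?V = "pverts G" and ?U = "with_proj (disjoint_union G G)"
  obtain F where F: "graph_isomorphism F (?U \<restriction> Inl ` ?V) (?U \<restriction> Inr ` ?V)"
    and lab: "\<forall>x\<in>Inl ` ?V.
      case_sum (vertex_label G l) (vertex_label G m) (F x) =
      case_sum (vertex_label G l) (vertex_label G m) x"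
    using assms unfolding type_1_def Let_def by blast
  have b: "bij_betw F (Inl ` ?V) (Inr ` ?V)"
    and e: "\<forall>x\<in>Inl ` ?V. \<forall>y\<in>Inl ` ?V.
      (x, y) \<in> parcs (disjoint_union G G) \<longleftrightarrow> (F x, F y) \<in> parcs (disjoint_union G G)"
    using F unfolding graph_isomorphism_induce_iff by blast+
  define t where "t = projr \<circ> (F \<circ> Inl)"
  have FI: "F (Inl v) = Inr (t v)" if "v \<in> ?V" for v
    using bij_betw_apply[OF b imageI[OF that]] by (auto simp: t_def)
  have "bij_betw Inl ?V (Inl ` ?V)" "bij_betw projr (Inr ` ?V) ?V"
    by (auto simp: bij_betw_def inj_on_def image_image)
  then have "bij_betw t ?V ?V"
    unfolding t_def using b by (intro bij_betw_trans)
  moreover have "(u, v) \<in> parcs G \<longleftrightarrow> (t u, t v) \<in> parcs G" if "u \<in> ?V" "v \<in> ?V" for u v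
    using bspec[OF bspec[OF e imageI[OF that(1)]] imageI[OF that(2)]] FI that by simp
  ultimately have "graph_automorphism t G" by (simp add: graph_isomorphism_with_proj)
  moreover have "\<forall>v\<in>?V. vertex_label G m (t v) = vertex_label G l v"
    using lab FI by simp
  ultimately show thesis by (rule that)
qed

section \<open>Unique colourability and type 2 of a component\<close>

context disconnected_udc_graph
begin

lemma distinguishing_component:
  assumes C: "C \<in> sccs_verts"
  shows "distinguishing (pair_induce G C) c"
  unfolding distinguishing_def with_proj_pair_induce parcs_pair_induce
  using proper colored_iso_trivial[OF C C] by auto

text \<open>Colour \<open>C\<close> by \<open>d\<close>, with colours renamed into those of
  \<open>c\<close> on \<open>C\<close>, and leave \<open>D\<close> as it is. If the result is
  distinguishing, uniqueness for \<open>G\<close> applies. If not, the recoloured \<open>C\<close>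
  is a coloured copy of \<open>D\<close>, and then \<open>d\<close> has the classes of
  \<open>c\<close> carried over from \<open>D\<close>, which are those of \<open>c\<close> on
  \<open>C\<close>.\<close>

lemma same_classes_component:
  fixes d :: "'a \<Rightarrow> nat"
  assumes C: "C \<in> sccs_verts" and D: "D \<in> sccs_verts" and CD: "C \<inter> D = {}" "C \<union> D = pverts G"
    and d: "distinguishing (pair_induce G C) d" and card: "card (d ` C) \<le> card (c ` C)"
  shows "same_classes C d c"
proof -
  have fin: "finite C" using component_subset[OF C] pair_finite_verts by (rule finite_subset)
  obtain g where g: "g ` d ` C \<subseteq> c ` C" "inj_on g (d ` C)"
    using card_le_inj[OF _ _ card] fin by auto
  have gd: "g (d u) = g (d v) \<longleftrightarrow> d u = d v" if "u \<in> C" "v \<in> C" for u v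
    using that g(2) by (auto dest: inj_onD)
  have d_proper: "d u \<noteq> d v" if "(u, v) \<in> parcs G" "u \<in> C" "v \<in> C" for u v
    using d that by (simp add: distinguishing_def parcs_pair_induce)
  have d_trivial: "f v = v" if "part_iso f C C" "\<And>v. v \<in> C \<Longrightarrow> d (f v) = d v" "v \<in> C" for f v
    using d that unfolding distinguishing_def with_proj_pair_induce pverts_pair_induce by blast
  define e where "e v = (if v \<in> C then g (d v) else c v)" for v
  have e_subset: "e ` pverts G \<subseteq> c ` pverts G"
    using g(1) component_subset[OF C] unfolding e_def by auto
  have key: "same_classes C d c" if h: "part_iso h C D" "\<And>v. v \<in> C \<Longrightarrow> c (h v) = g (d v)" for h
    using same_classes_iso[OF C D h(1)] h(2) gd by (simp add: same_classes_def)
  show ?thesis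
  proof (cases "distinguishing G e")
    case True
    then have s: "same_classes (pverts G) e c" using e_subset by (rule unique_subset)
    show ?thesis
      unfolding same_classes_def
    proof (intro ballI)
      fix u v assume uv: "u \<in> C" "v \<in> C"
      then have "e u = e v \<longleftrightarrow> c u = c v"
        using s component_subset[OF C] unfolding same_classes_def by blast
      then show "d u = d v \<longleftrightarrow> c u = c v" using uv gd by (simp add: e_def)
    qed
  next
    case False
    have "e u \<noteq> e v" if uv: "(u, v) \<in> parcs G" for u v
      using component_arc[OF C uv] proper[OF uv] d_proper[OF uv] gd by (auto simp: e_def)
    with False obtain E F f w where E: "E \<in> sccs_verts" and F: "F \<in> sccs_verts"
      and f: "part_iso f E F" and ef: "\<And>v. v \<in> E \<Longrightarrow> e (f v) = e v" and w: "w \<in> E" "f w \<noteq> w"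
      unfolding distinguishing_iff_components by blast
    have only: "K = C \<or> K = D" if K: "K \<in> sccs_verts" for K
      using component_nonempty[OF K] component_subset[OF K] component_eq[OF K C] component_eq[OF K D]
        CD(2) by blast
    have eC: "e v = g (d v)" if "v \<in> C" for v using that by (simp add: e_def)
    have eD: "e v = c v" if "v \<in> D" for v using that CD(1) by (auto simp: e_def)
    have fw: "\<And>v. v \<in> E \<Longrightarrow> f v \<in> F" by (rule part_iso_apply[OF f])
    \<comment> \<open>The first two cases contradict nontriviality of \<open>f\<close>, as
      \<open>d\<close> and \<open>c\<close> are distinguishing on their components. The last two
      provide the isomorphism for \<open>key\<close>, by \<open>f\<close> or by its inverse.\<close>
    consider "E = C" "F = C" | "E = D" "F = D" | "E = C" "F = D" | "E = D" "F = C"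
      using only[OF E] only[OF F] by blast
    then show ?thesis
    proof cases
      case 1
      have "d (f v) = d v" if "v \<in> C" for v
        using ef[of v] fw[of v] that 1 gd[of "f v" v] eC by simp
      then show ?thesis using d_trivial f w 1 by blast
    next
      case 2
      have "c (f v) = c v" if "v \<in> D" for v
        using ef[of v] fw[of v] that 2 eD by simp
      then show ?thesis using colored_iso_trivial[OF D D] f w 2 by blast
    next
      case 3
      have "c (f v) = g (d v)" if "v \<in> C" for v
        using ef[of v] fw[of v] that 3 eC eD by simp
      then show ?thesis using key f 3 by blast
    next
      case 4
      have "c (inv_into D f v) = g (d v)" if "v \<in> C" for v
        using ef[of "inv_into D f v"] part_iso_inv_into[OF f, of v] that 4 eC eD by simp
      then show ?thesis using key part_iso_inv f 4 by blast
    qed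
  qed
qed

lemma decomposition:
  obtains H :: "'a pair_pre_digraph" where "pair_graph H" "connected H"
    "uniquely_distinguishing_colorable H" "type_2 H" "digraph_iso G (disjoint_union H H)"
proof -
  obtain C D where C: "C \<in> sccs_verts" and D: "D \<in> sccs_verts"
    and CD: "C \<inter> D = {}" "C \<union> D = pverts G"
    by (rule two_components)
  have neq: "C \<noteq> D" using CD component_nonempty[OF C] by blast
  obtain f where f: "part_iso f C D" using components_isomorphic[OF C D] by blast
  let ?H = "pair_induce G C"
  have H: "pair_graph ?H" by (rule pair_graph_pair_induce[OF component_subset[OF C]])
  have uniq: "same_classes (pverts ?H) d c"
    if "distinguishing ?H d" "card (d ` pverts ?H) \<le> card (c ` pverts ?H)" for d :: "'a \<Rightarrow> nat"
    using same_classes_component[OF C D CD] that by simp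
  note udc = uniquely_distinguishing_colorableI[OF H distinguishing_component[OF C] uniq]
  have b: "bij_betw f C D" using f by (simp add: graph_isomorphism_induce_iff)
  then have fC: "f ` C = D" by (simp add: bij_betw_def)
  have "c ` D = c ` pverts G"
    using all_colors_in_component[OF D C] CD by (simp add: Int_commute Un_commute)
  then have colors: "c ` D = c ` C"
    using all_colors_in_component[OF C D CD] by simp
  have "type_2 ?H"
    unfolding type_2_def
  proof
    assume t1: "type_1 ?H"
    have "finite (c ` C)"
      by (rule finite_imageI[OF finite_subset[OF component_subset[OF C] pair_finite_verts]])
    then obtain h where h: "bij_betw h (c ` C) {1..card (c ` C)}"
      using finite_same_card_bij[of "c ` C" "{1..card (c ` C)}"] by auto
    \<comment> \<open>Both components use the same colours, so the one bijection \<open>h\<close>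
      serves for \<open>c\<close> and for \<open>c \<circ> f\<close>. This yields two labelings
      \<open>l\<close> and \<open>m\<close> of the optimal partition of \<open>?H\<close>, copying
      the colourings of \<open>C\<close> and of \<open>D\<close>.\<close>
    have img: "(c \<circ> f) ` C = c ` C" by (simp only: image_comp[symmetric] fC colors)
    have part: "optimal_partition ?H = classes (pverts ?H) (c \<circ> f)"
      using udc(3) same_classes_iso[OF C D f] by (simp add: classes_eq_iff[symmetric])
    have l: "class_labeling ?H (\<lambda>X. h (the_elem (c ` X)))"
      using udc h by (intro class_labeling_classes) simp_all
    have m: "class_labeling ?H (\<lambda>X. h (the_elem ((c \<circ> f) ` X)))"
      using udc(1) h part img by (intro class_labeling_classes) (simp_all add: comp_def)
    obtain t where t: "graph_automorphism t ?H"
      and lab: "\<forall>v\<in>pverts ?H. vertex_label ?H (\<lambda>X. h (the_elem ((c \<circ> f) ` X))) (t v) =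
        vertex_label ?H (\<lambda>X. h (the_elem (c ` X))) v"
      by (rule type_1_isomorphism[OF t1 l m])
    have t': "part_iso t C C" using t by (simp add: with_proj_pair_induce)
    \<comment> \<open>If \<open>?H\<close> were of type 1, following \<open>t\<close> by
      \<open>f\<close> would give a coloured isomorphism from \<open>C\<close> onto
      \<open>D\<close>.\<close>
    have "c ((f \<circ> t) v) = c v" if v: "v \<in> C" for v
    proof -
      have tv: "t v \<in> C" by (rule part_iso_apply[OF t' v])
      have "h ((c \<circ> f) (t v)) = h (c v)"
        using lab vertex_label_classes[OF part, of "t v" h] vertex_label_classes[OF udc(3), of v h] tv v
        by simp
      moreover have "(c \<circ> f) (t v) \<in> c ` C" using img tv by blast
      ultimately show ?thesis using h v by (auto simp: bij_betw_def dest: inj_onD)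
    qed
    then have "C = D"
      by (rule colored_iso_same_component[OF C D graph_isomorphism_comp[OF t' f]])
    then show False using neq by simp
  qed
  moreover have "digraph_iso G (disjoint_union ?H ?H)"
  proof -
    \<comment> \<open>The left copy is mapped identically onto \<open>C\<close>, the right copy
      along \<open>f\<close> onto \<open>D\<close>.\<close>
    let ?n = "case_sum id f" and ?U = "disjoint_union ?H ?H"
    have "bij_betw ?n (Inl ` C) C"
      by (simp add: bij_betw_def inj_on_def image_image)
    moreover have "bij_betw ?n (Inr ` C) D"
      using b by (simp add: bij_betw_def inj_on_def image_image)
    ultimately have "bij_betw ?n (C <+> C) (C \<union> D)"
      using CD(1) unfolding Plus_def by (rule bij_betw_combine)
    moreover have "(x, y) \<in> parcs ?U \<longleftrightarrow> (?n x, ?n y) \<in> parcs G"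
      if xy: "x \<in> C <+> C" "y \<in> C <+> C" for x y
    proof -
      have "(u, f v) \<notin> parcs G" "(f v, u) \<notin> parcs G" if "u \<in> C" "v \<in> C" for u v
        using that fC CD(1) component_arc[OF C, of u "f v"] component_arc[OF C, of "f v" u] by blast+
      then show ?thesis
        using xy f by (auto simp: parcs_pair_induce graph_isomorphism_induce_iff)
    qed
    ultimately have "graph_isomorphism ?n ?U G"
      by (simp add: graph_isomorphism_with_proj CD(2))
    then have "\<exists>g. graph_isomorphism g G ?U" using graph_isomorphism_inv_into by blast
    moreover have "pair_wf_digraph ?H" using H by (simp add: pair_graph_def pair_digraph_def pair_fin_digraph_def)
    ultimately show ?thesis
      using digraph_iso_iff_graph_isomorphism pair_wf_digraph_disjoint_union pair_wf_digraph_axioms by blast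
  qed
  ultimately show thesis using that H connected_pair_induce[OF C] udc(2) by blast
qed

end

theorem theorem3p6:
  fixes G :: "'a pair_pre_digraph"
  assumes "pair_graph G"
    and "parcs G \<noteq> {}"
    and "uniquely_distinguishing_colorable G"
  shows "connected G \<or>
    (\<exists>H :: 'a pair_pre_digraph.
        pair_graph H \<and> connected H \<and> uniquely_distinguishing_colorable H \<and> type_2 H \<and>
        digraph_iso G (disjoint_union H H))"
proof (cases "connected G")
  case False
  interpret pair_graph G by fact
  obtain c :: "'a \<Rightarrow> nat" where "distinguishing G c"
    and "\<And>d :: 'a \<Rightarrow> nat. distinguishing G d \<Longrightarrow> card (d ` pverts G) \<le> card (c ` pverts G) \<Longrightarrow>
      same_classes (pverts G) d c"
    using uniquely_distinguishing_colorableD[OF assms(1,3)] by blast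
  then interpret disconnected_udc_graph G c
    using assms(2) False by unfold_locales
  show ?thesis using decomposition by blast
qed simp

end
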